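(* Upon a rotational surface $M$ in a Bianchi-Cartan-Vranceanu space (BCV-space), a loxodrome which is neither a meridian nor a parallel cannot be a geodesic of $M$ unless $M$ is a vertical cylinder.
   Context: For $\ell,m\in\mathbb{R}$ the BCV-space is $N=\mathbb{R}^3$ if $m\ge 0$ and $N=\{(x,y,z)\in\mathbb{R}^3: x^2+y^2<-1/m\}$ otherwise, with the metric $$g_{\ell,m}=\frac{dx^2+dy^2}{[1+m(x^2+y^2)]^2}+\left(dz+\frac{\ell}{2}\,\frac{y\,dx-x\,dy}{1+m(x^2+y^2)}\right)^2 .$$ The Killing vector field $X=-y\,\partial_x+x\,\partial_y$ generates a one-parameter group of isometries isomorphic to $SO(2)$. A rotational surface is an immersed surface invariant under this group (contained in the union of the principal orbits), with the induced metric; it is parametrized by $\psi(u,v)=(f(u)\cos v,f(u)\sin v,h(u))$, where $f>0$ is the Euclidean radius of the orbit and $u$ is the arc-length parameter of the projection of the surface to the orbit space with the quotient metric. It is a vertical cylinder if $f$ is constant. Parallels are the orbits of $X$ on the surface (the curves $u=$ constant); meridians are the curves $v=$ constant. A loxodrome is a curve on the surface making a constant angle $\vartheta_0\in[0,\pi)$ with $X$: parametrized by arc length, $g_{\ell,m}(\alpha',X)=\|X\|\cos\vartheta_0$.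
   Formalization: Loxodromes orthogonal to the parallels (angle π/2) are excluded besides the meridians v = const, since they are always geodesics; for an arc of loxodrome only the part of M it crosses is shown to be a vertical cylinder, and all of M if the loxodrome is inextendible. *)

theory Defs
  imports "HOL-Analysis.Analysis"
begin

abbreviation velocity :: "(real \<Rightarrow> 'a::real_normed_vector) \<Rightarrow> real \<Rightarrow> 'a"
  where "velocity \<gamma> s \<equiv> vector_derivative \<gamma> (at s)"

definition smooth_curve_on :: "real set \<Rightarrow> (real \<Rightarrow> 'a::real_normed_vector) \<Rightarrow> bool"
  where "smooth_curve_on S \<gamma> \<longleftrightarrow> (\<forall>n. \<forall>s\<in>S. (velocity ^^ n) \<gamma> differentiable (at s))"

definition pderiv_coord :: "'n::finite \<Rightarrow> (real ^ 'n \<Rightarrow> 'a::real_normed_vector) \<Rightarrow> real ^ 'n \<Rightarrow> 'a"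
  where "pderiv_coord i F p = vector_derivative (\<lambda>t. F (p + t *\<^sub>R axis i 1)) (at 0)"

subsection \<open>Bianchi-Cartan-Vranceanu spaces\<close>

definition bcv_domain :: "real \<Rightarrow> (real ^ 3) set"
  where "bcv_domain m = (if m \<ge> 0 then UNIV else {p. (p $ 1)\<^sup>2 + (p $ 2)\<^sup>2 < - 1 / m})"

definition bcv_factor :: "real \<Rightarrow> real ^ 3 \<Rightarrow> real"
  where "bcv_factor m p = 1 + m * ((p $ 1)\<^sup>2 + (p $ 2)\<^sup>2)"

definition bcv_form :: "real \<Rightarrow> real \<Rightarrow> real ^ 3 \<Rightarrow> real ^ 3 \<Rightarrow> real"
  where "bcv_form l m p a = a $ 3 + l / 2 * ((p $ 2 * a $ 1 - p $ 1 * a $ 2) / bcv_factor m p)"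

definition bcv_metric :: "real \<Rightarrow> real \<Rightarrow> real ^ 3 \<Rightarrow> real ^ 3 \<Rightarrow> real ^ 3 \<Rightarrow> real"
  where "bcv_metric l m p a b =
    (a $ 1 * b $ 1 + a $ 2 * b $ 2) / (bcv_factor m p)\<^sup>2 + bcv_form l m p a * bcv_form l m p b"

definition bcv_norm :: "real \<Rightarrow> real \<Rightarrow> real ^ 3 \<Rightarrow> real ^ 3 \<Rightarrow> real"
  where "bcv_norm l m p a = sqrt (bcv_metric l m p a a)"

definition rot_field :: "real ^ 3 \<Rightarrow> real ^ 3"
  where "rot_field p = vector [- (p $ 2), p $ 1, 0]"

text \<open>The quotient metric on the orbit space makes the projection a Riemannian submersion, so the
  projection of a tangent vector has the length of its component orthogonal to the orbits.\<close>

definition orbit_orthogonal_part :: "real \<Rightarrow> real \<Rightarrow> real ^ 3 \<Rightarrow> real ^ 3 \<Rightarrow> real ^ 3"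
  where "orbit_orthogonal_part l m p a =
    a - (bcv_metric l m p a (rot_field p) / bcv_metric l m p (rot_field p) (rot_field p)) *\<^sub>R rot_field p"

definition orbit_space_norm :: "real \<Rightarrow> real \<Rightarrow> real ^ 3 \<Rightarrow> real ^ 3 \<Rightarrow> real"
  where "orbit_space_norm l m p a = bcv_norm l m p (orbit_orthogonal_part l m p a)"

subsection \<open>Rotational surfaces\<close>

text \<open>Points of the parameter domain are vectors \<open>q\<close> with \<open>q $ 1 = u\<close> and \<open>q $ 2 = v\<close>.\<close>

definition rot_param :: "(real \<Rightarrow> real) \<Rightarrow> (real \<Rightarrow> real) \<Rightarrow> real ^ 2 \<Rightarrow> real ^ 3"
  where "rot_param f h q = vector [f (q $ 1) * cos (q $ 2), f (q $ 1) * sin (q $ 2), h (q $ 1)]"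

definition rotational_surface ::
    "real \<Rightarrow> real \<Rightarrow> real set \<Rightarrow> (real \<Rightarrow> real) \<Rightarrow> (real \<Rightarrow> real) \<Rightarrow> bool"
  where "rotational_surface l m I f h \<longleftrightarrow>
    open I \<and> connected I \<and> I \<noteq> {} \<and> smooth_curve_on I f \<and> smooth_curve_on I h \<and>
    (\<forall>u\<in>I. f u > 0) \<and>
    (\<forall>q. q $ 1 \<in> I \<longrightarrow> rot_param f h q \<in> bcv_domain m) \<and>
    (\<forall>q. q $ 1 \<in> I \<longrightarrow>
      orbit_space_norm l m (rot_param f h q) (pderiv_coord 1 (rot_param f h) q) = 1)"

definition vertical_cylinder :: "real set \<Rightarrow> (real \<Rightarrow> real) \<Rightarrow> bool"
  where "vertical_cylinder I f \<longleftrightarrow> f constant_on I"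

definition first_fundamental_form ::
    "real \<Rightarrow> real \<Rightarrow> (real \<Rightarrow> real) \<Rightarrow> (real \<Rightarrow> real) \<Rightarrow> real ^ 2 \<Rightarrow> real ^ 2 ^ 2"
  where "first_fundamental_form l m f h q =
    (\<chi> i j. bcv_metric l m (rot_param f h q)
       (pderiv_coord i (rot_param f h) q) (pderiv_coord j (rot_param f h) q))"

subsection \<open>Geodesics in a coordinate chart\<close>

definition christoffel ::
    "(real ^ 'n \<Rightarrow> real ^ 'n ^ 'n) \<Rightarrow> real ^ 'n \<Rightarrow> 'n::finite \<Rightarrow> 'n \<Rightarrow> 'n \<Rightarrow> real"
  where "christoffel g q k i j =
    (\<Sum>r\<in>UNIV. matrix_inv (g q) $ k $ r / 2 *
      (pderiv_coord i (\<lambda>x. g x $ j $ r) q + pderiv_coord j (\<lambda>x. g x $ i $ r) q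
       - pderiv_coord r (\<lambda>x. g x $ i $ j) q))"

definition geodesic_on ::
    "(real ^ 'n \<Rightarrow> real ^ 'n ^ 'n) \<Rightarrow> real set \<Rightarrow> (real \<Rightarrow> real ^ 'n::finite) \<Rightarrow> bool"
  where "geodesic_on g J \<gamma> \<longleftrightarrow>
    (\<forall>s\<in>J. \<forall>k. velocity (velocity \<gamma>) s $ k
      + (\<Sum>i\<in>UNIV. \<Sum>j\<in>UNIV. christoffel g (\<gamma> s) k i j * velocity \<gamma> s $ i * velocity \<gamma> s $ j) = 0)"

subsection \<open>Curves on a rotational surface\<close>

text \<open>A curve on the immersed surface is given by a lift \<open>\<gamma>\<close> to the parameter domain
  \<open>{q. q $ 1 \<in> I}\<close> (a covering of the surface); the curve itself is \<open>rot_param f h \<circ> \<gamma>\<close>.\<close>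

definition loxodrome ::
    "real \<Rightarrow> real \<Rightarrow> real set \<Rightarrow> (real \<Rightarrow> real) \<Rightarrow> (real \<Rightarrow> real) \<Rightarrow> real \<Rightarrow>
     real set \<Rightarrow> (real \<Rightarrow> real ^ 2) \<Rightarrow> bool"
  where "loxodrome l m I f h \<theta> J \<gamma> \<longleftrightarrow>
    open J \<and> connected J \<and> J \<noteq> {} \<and> 0 \<le> \<theta> \<and> \<theta> < pi \<and>
    smooth_curve_on J \<gamma> \<and> (\<forall>s\<in>J. \<gamma> s $ 1 \<in> I) \<and>
    (let \<alpha> = rot_param f h \<circ> \<gamma> in
      \<forall>s\<in>J. bcv_norm l m (\<alpha> s) (velocity \<alpha> s) = 1 \<and>
        bcv_metric l m (\<alpha> s) (velocity \<alpha> s) (rot_field (\<alpha> s))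
          = bcv_norm l m (\<alpha> s) (rot_field (\<alpha> s)) * cos \<theta>)"

definition inextendible_loxodrome ::
    "real \<Rightarrow> real \<Rightarrow> real set \<Rightarrow> (real \<Rightarrow> real) \<Rightarrow> (real \<Rightarrow> real) \<Rightarrow> real \<Rightarrow>
     real set \<Rightarrow> (real \<Rightarrow> real ^ 2) \<Rightarrow> bool"
  where "inextendible_loxodrome l m I f h \<theta> J \<gamma> \<longleftrightarrow>
    loxodrome l m I f h \<theta> J \<gamma> \<and>
    (\<forall>K \<beta>. loxodrome l m I f h \<theta> K \<beta> \<and> J \<subseteq> K \<and> (\<forall>s\<in>J. \<beta> s = \<gamma> s) \<longrightarrow> K = J)"

definition parallel_curve :: "real set \<Rightarrow> (real \<Rightarrow> real ^ 2) \<Rightarrow> bool"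
  where "parallel_curve J \<gamma> \<longleftrightarrow> (\<lambda>s. \<gamma> s $ 1) constant_on J"

text \<open>If \<open>l \<noteq> 0\<close> and \<open>h\<close> is not constant, the curves \<open>v = const\<close> are in general not orthogonal to the
  parallels: being a meridian is not the same as making the angle \<open>pi / 2\<close> with \<open>rot_field\<close>.
  The curves of angle \<open>pi / 2\<close> are geodesics of every rotational surface.\<close>

definition meridian_curve :: "real set \<Rightarrow> (real \<Rightarrow> real ^ 2) \<Rightarrow> bool"
  where "meridian_curve J \<gamma> \<longleftrightarrow> (\<lambda>s. \<gamma> s $ 2) constant_on J"

end

theory Submission
  imports Defs
begin

text \<open>In the coordinates \<open>(u, v)\<close> the induced metric is
  \<open>E du\<^sup>2 + 2 F du dv + G dv\<^sup>2\<close> with coefficients depending on \<open>u\<close> only, and the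
  parametrization of the orbit space by arc length says \<open>E G - F\<^sup>2 = G\<close>. The second geodesic
  equation is the Clairaut relation \<open>F u' + G v' = const\<close>, whereas a loxodrome satisfies
  \<open>F u' + G v' = sqrt G * cos \<theta>\<close>; hence \<open>G\<close> is constant along a geodesic loxodrome with
  \<open>\<theta> \<noteq> pi / 2\<close>. Since \<open>G\<close> is a nonconstant rational function of \<open>f\<close>, the radius \<open>f\<close> takes
  only finitely many values along the curve and is therefore constant there. Finally unit speed
  gives \<open>u'\<^sup>2 = (sin \<theta>)\<^sup>2\<close>, so \<open>u\<close> is affine, and integrating the loxodrome equation for \<open>v'\<close>
  extends the curve over all of \<open>I\<close>.\<close>

subsection \<open>Smooth functions of one real variable\<close>

lemma has_vector_derivative_vec_iff:
  fixes \<phi> :: "real \<Rightarrow> real ^ 'n"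
  shows "(\<phi> has_vector_derivative d) (at s) \<longleftrightarrow>
    (\<forall>i. ((\<lambda>t. \<phi> t $ i) has_real_derivative d $ i) (at s))"
proof
  assume "(\<phi> has_vector_derivative d) (at s)"
  then show "\<forall>i. ((\<lambda>t. \<phi> t $ i) has_real_derivative d $ i) (at s)"
    by (simp add: has_real_derivative_iff_has_vector_derivative
        bounded_linear.has_vector_derivative[OF bounded_linear_vec_nth])
next
  assume "\<forall>i. ((\<lambda>t. \<phi> t $ i) has_real_derivative d $ i) (at s)"
  then show "(\<phi> has_vector_derivative d) (at s)"
    unfolding has_vector_derivative_def has_real_derivative_iff_has_vector_derivative
    by (subst has_derivative_componentwise_within) (auto simp: Basis_vec_def inner_axis)
qed

lemma smooth_curve_on_has_derivative:
  assumes "smooth_curve_on S \<phi>" "s \<in> S"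
  shows "(\<phi> has_vector_derivative velocity \<phi> s) (at s)"
  using assms unfolding smooth_curve_on_def
  by (metis funpow_0 vector_derivative_works)

lemma smooth_curve_on_velocity:
  assumes "smooth_curve_on S \<phi>"
  shows "smooth_curve_on S (velocity \<phi>)"
  using assms unfolding smooth_curve_on_def
  by (metis (no_types, lifting) comp_apply funpow_Suc_right)

text \<open>Each differentiation stays inside \<open>P\<close>, so every iterated
  \<open>velocity\<close> of \<open>\<psi>\<close> is differentiable. Smoothness is thus proved by
  exhibiting an invariant class instead of formulas for all higher derivatives.\<close>

lemma smooth_curve_on_coinduct:
  assumes "open S" "P \<psi>"
    and step: "\<And>\<phi>. P \<phi> \<Longrightarrow> \<exists>\<phi>'. P \<phi>' \<and> (\<forall>s\<in>S. (\<phi> has_vector_derivative \<phi>' s) (at s))"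
  shows "smooth_curve_on S \<psi>"
proof -
  have der: "((velocity ^^ n) \<psi> has_vector_derivative \<phi>' s) (at s)"
    if "\<forall>s\<in>S. (velocity ^^ n) \<psi> s = \<phi> s"
      "\<forall>s\<in>S. (\<phi> has_vector_derivative \<phi>' s) (at s)" "s \<in> S" for n \<phi> \<phi>' s
    using has_vector_derivative_transform_within_open[of \<phi> "\<phi>' s" s S] that \<open>open S\<close> by simp
  \<comment> \<open>Agreement is claimed on \<open>S\<close> only, since outside it
    \<open>\<phi>'\<close> need not be a derivative. Openness of \<open>S\<close> makes this enough,
    by \<open>der\<close>.\<close>
  have iter: "\<exists>\<phi>. P \<phi> \<and> (\<forall>s\<in>S. (velocity ^^ n) \<psi> s = \<phi> s)" for n
  proof (induction n)
    case 0
    then show ?case using \<open>P \<psi>\<close> by auto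
  next
    case (Suc n)
    then obtain \<phi> where \<phi>: "P \<phi>" "\<forall>s\<in>S. (velocity ^^ n) \<psi> s = \<phi> s" by blast
    obtain \<phi>' where \<phi>': "P \<phi>'" "\<forall>s\<in>S. (\<phi> has_vector_derivative \<phi>' s) (at s)"
      using step[OF \<phi>(1)] by blast
    have "(velocity ^^ Suc n) \<psi> s = \<phi>' s" if "s \<in> S" for s
      using vector_derivative_at[OF der[OF \<phi>(2) \<phi>'(2) that]] by simp
    then show ?case using \<phi>'(1) by blast
  qed
  have "(velocity ^^ n) \<psi> differentiable (at s)" if "s \<in> S" for n s
  proof -
    obtain \<phi> where \<phi>: "P \<phi>" "\<forall>s\<in>S. (velocity ^^ n) \<psi> s = \<phi> s" using iter by blast
    obtain \<phi>' where \<phi>': "\<forall>s\<in>S. (\<phi> has_vector_derivative \<phi>' s) (at s)"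
      using step[OF \<phi>(1)] by blast
    show ?thesis by (rule differentiableI_vector[OF der[OF \<phi>(2) \<phi>' that]])
  qed
  then show ?thesis by (simp add: smooth_curve_on_def)
qed

text \<open>The generators are the operations occurring in the metric coefficients and in the
  angular speed of a loxodrome. One differentiation rule per generator then makes the class an
  invariant for \<open>smooth_curve_on_coinduct\<close>.\<close>

inductive_set smooth_closure :: "real set \<Rightarrow> (real \<Rightarrow> real) set" for S where
  smooth: "smooth_curve_on S \<phi> \<Longrightarrow> \<phi> \<in> smooth_closure S"
| add: "\<phi> \<in> smooth_closure S \<Longrightarrow> \<psi> \<in> smooth_closure S \<Longrightarrow> (\<lambda>s. \<phi> s + \<psi> s) \<in> smooth_closure S"
| mult: "\<phi> \<in> smooth_closure S \<Longrightarrow> \<psi> \<in> smooth_closure S \<Longrightarrow> (\<lambda>s. \<phi> s * \<psi> s) \<in> smooth_closure S"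
| inverse: "\<phi> \<in> smooth_closure S \<Longrightarrow> (\<And>s. s \<in> S \<Longrightarrow> \<phi> s \<noteq> 0) \<Longrightarrow>
    (\<lambda>s. inverse (\<phi> s)) \<in> smooth_closure S"
| sqrt: "\<phi> \<in> smooth_closure S \<Longrightarrow> (\<And>s. s \<in> S \<Longrightarrow> \<phi> s > 0) \<Longrightarrow>
    (\<lambda>s. sqrt (\<phi> s)) \<in> smooth_closure S"

lemma smooth_curve_on_const:
  fixes c :: real
  assumes "open S"
  shows "smooth_curve_on S (\<lambda>s. c)"
proof (rule smooth_curve_on_coinduct[OF assms, where P = "\<lambda>\<phi>. \<exists>c. \<phi> = (\<lambda>s. c)"])
  fix \<phi> :: "real \<Rightarrow> real" assume "\<exists>c. \<phi> = (\<lambda>s. c)"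
  then show "\<exists>\<phi>'. (\<exists>c. \<phi>' = (\<lambda>s. c)) \<and> (\<forall>s\<in>S. (\<phi> has_vector_derivative \<phi>' s) (at s))"
    by (intro exI[of _ "\<lambda>s. 0"]) auto
qed auto

lemma smooth_closure_const: "open S \<Longrightarrow> (\<lambda>s. c) \<in> smooth_closure S"
  by (intro smooth_closure.smooth smooth_curve_on_const)

lemma smooth_closure_uminus:
  "open S \<Longrightarrow> \<phi> \<in> smooth_closure S \<Longrightarrow> (\<lambda>s. - \<phi> s) \<in> smooth_closure S"
  using smooth_closure.mult[OF smooth_closure_const[of S "- 1"]] by simp

lemma smooth_closure_power2: "\<phi> \<in> smooth_closure S \<Longrightarrow> (\<lambda>s. (\<phi> s)\<^sup>2) \<in> smooth_closure S"
  unfolding power2_eq_square by (rule smooth_closure.mult)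

lemma smooth_closure_divide:
  "\<phi> \<in> smooth_closure S \<Longrightarrow> \<psi> \<in> smooth_closure S \<Longrightarrow> (\<And>s. s \<in> S \<Longrightarrow> \<psi> s \<noteq> 0) \<Longrightarrow>
    (\<lambda>s. \<phi> s / \<psi> s) \<in> smooth_closure S"
  unfolding divide_inverse by (intro smooth_closure.mult smooth_closure.inverse)

text \<open>The sum, product, reciprocal and root rules express a derivative through the same
  operations, so differentiation does not leave the class.\<close>

lemma smooth_closure_has_derivative:
  assumes "open S" "\<phi> \<in> smooth_closure S"
  shows "\<exists>\<phi>'\<in>smooth_closure S. \<forall>s\<in>S. (\<phi> has_real_derivative \<phi>' s) (at s)"
  using assms(2)
proof induction
  case (smooth \<phi>)
  then show ?case
    using smooth_curve_on_velocity[OF smooth] smooth_curve_on_has_derivative[OF smooth]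
    by (intro bexI[of _ "velocity \<phi>"])
      (auto simp: has_real_derivative_iff_has_vector_derivative intro: smooth_closure.smooth)
next
  case (add \<phi> \<psi>)
  then obtain \<phi>' \<psi>' where "\<phi>' \<in> smooth_closure S" "\<psi>' \<in> smooth_closure S"
    "\<forall>s\<in>S. (\<phi> has_real_derivative \<phi>' s) (at s)"
    "\<forall>s\<in>S. (\<psi> has_real_derivative \<psi>' s) (at s)" by blast
  then show ?case
    by (intro bexI[of _ "\<lambda>s. \<phi>' s + \<psi>' s"])
      (auto intro!: derivative_eq_intros smooth_closure.intros(2-))
next
  case (mult \<phi> \<psi>)
  then obtain \<phi>' \<psi>' where "\<phi>' \<in> smooth_closure S" "\<psi>' \<in> smooth_closure S"
    "\<forall>s\<in>S. (\<phi> has_real_derivative \<phi>' s) (at s)"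
    "\<forall>s\<in>S. (\<psi> has_real_derivative \<psi>' s) (at s)" by blast
  then show ?case using mult
    by (intro bexI[of _ "\<lambda>s. \<phi>' s * \<psi> s + \<psi>' s * \<phi> s"])
      (auto intro!: DERIV_mult smooth_closure.intros(2-))
next
  case (inverse \<phi>)
  then obtain \<phi>' where \<phi>': "\<phi>' \<in> smooth_closure S"
    "\<forall>s\<in>S. (\<phi> has_real_derivative \<phi>' s) (at s)" by blast
  have c: "(\<lambda>s. - 1) \<in> smooth_closure S"
    by (rule smooth_closure_const[OF assms(1)])
  have "(\<lambda>s. inverse (\<phi> s)) \<in> smooth_closure S"
    using inverse(1,2) by (rule smooth_closure.inverse)
  \<comment> \<open>The derivative \<open>- \<phi>' / \<phi>\<^sup>2\<close> is spelled as a product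
    with the constant \<open>- 1\<close>, so that the generators of the class apply.\<close>
  then have "(\<lambda>s. - 1 * (inverse (\<phi> s) * \<phi>' s * inverse (\<phi> s))) \<in> smooth_closure S"
    using c \<phi>'(1) by (intro smooth_closure.mult)
  moreover have "((\<lambda>s. inverse (\<phi> s)) has_real_derivative
      - 1 * (inverse (\<phi> s) * \<phi>' s * inverse (\<phi> s))) (at s)" if "s \<in> S" for s
    using \<phi>'(2) inverse(2) that by (auto intro!: derivative_eq_intros)
  ultimately show ?case by (intro bexI ballI)
next
  case (sqrt \<phi>)
  then obtain \<phi>' where \<phi>': "\<phi>' \<in> smooth_closure S"
    "\<forall>s\<in>S. (\<phi> has_real_derivative \<phi>' s) (at s)" by blast
  have c: "(\<lambda>s. inverse 2) \<in> smooth_closure S"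
    by (rule smooth_closure_const[OF assms(1)])
  have "(\<lambda>s. sqrt (\<phi> s)) \<in> smooth_closure S" "\<forall>s\<in>S. sqrt (\<phi> s) \<noteq> 0"
    using sqrt by (force intro: smooth_closure.sqrt)+
  then have "(\<lambda>s. inverse (sqrt (\<phi> s))) \<in> smooth_closure S"
    by (auto intro: smooth_closure.inverse)
  then have "(\<lambda>s. inverse (sqrt (\<phi> s)) * inverse 2 * \<phi>' s) \<in> smooth_closure S"
    using c \<phi>'(1) by (intro smooth_closure.mult)
  moreover have "((\<lambda>s. sqrt (\<phi> s)) has_real_derivative
      inverse (sqrt (\<phi> s)) * inverse 2 * \<phi>' s) (at s)" if "s \<in> S" for s
    using DERIV_chain2[where f = sqrt and g = \<phi>,
        OF DERIV_real_sqrt[OF sqrt(2)[OF that]] bspec[OF \<phi>'(2) that]]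
    by (simp only: divide_inverse)
  ultimately show ?case by (intro bexI ballI)
qed

text \<open>Closure under differentiation makes the class a legitimate invariant; smooth functions
  thereby inherit all closure properties of \<open>smooth_closure\<close>.\<close>

lemma smooth_closure_iff:
  assumes "open S"
  shows "\<phi> \<in> smooth_closure S \<longleftrightarrow> smooth_curve_on S \<phi>"
proof
  assume "\<phi> \<in> smooth_closure S"
  then show "smooth_curve_on S \<phi>"
    by (rule smooth_curve_on_coinduct[OF assms, where P = "\<lambda>\<phi>. \<phi> \<in> smooth_closure S"])
      (use smooth_closure_has_derivative[OF assms] in
        \<open>auto simp: has_real_derivative_iff_has_vector_derivative\<close>)
qed (rule smooth_closure.smooth)

section \<open>Affine reparametrization, antiderivatives and pairs of smooth functions\<close>

lemma smooth_curve_on_compose_affine: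
  fixes \<phi> :: "real \<Rightarrow> real"
  assumes "open K" "smooth_curve_on S \<phi>" "\<And>s. s \<in> K \<Longrightarrow> a + c * s \<in> S"
  shows "smooth_curve_on K (\<lambda>s. \<phi> (a + c * s))"
\<comment> \<open>The chain rule brings out a factor \<open>c\<close> at each differentiation; the
  invariant therefore carries a free scalar \<open>d\<close>.\<close>
proof (rule smooth_curve_on_coinduct[OF assms(1),
      where P = "\<lambda>\<psi>. \<exists>d \<phi>. smooth_curve_on S \<phi> \<and> \<psi> = (\<lambda>s. d * \<phi> (a + c * s))"])
  show "\<exists>d \<omega>. smooth_curve_on S \<omega> \<and> (\<lambda>s. \<phi> (a + c * s)) = (\<lambda>s. d * \<omega> (a + c * s))"
    using assms(2) by (intro exI[of _ 1] exI[of _ \<phi>]) simp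
next
  fix \<psi> :: "real \<Rightarrow> real" assume "\<exists>d \<phi>. smooth_curve_on S \<phi> \<and> \<psi> = (\<lambda>s. d * \<phi> (a + c * s))"
  then obtain d \<phi> where \<phi>: "smooth_curve_on S \<phi>" "\<psi> = (\<lambda>s. d * \<phi> (a + c * s))" by blast
  have "(\<psi> has_real_derivative (d * c) * velocity \<phi> (a + c * s)) (at s)" if "s \<in> K" for s
  proof -
    have "(\<phi> has_real_derivative velocity \<phi> (a + c * s)) (at (a + c * s))"
      using smooth_curve_on_has_derivative[OF \<phi>(1) assms(3)[OF that]]
      by (simp add: has_real_derivative_iff_has_vector_derivative)
    moreover have "((\<lambda>s. a + c * s) has_real_derivative c) (at s)"
      by (auto intro!: derivative_eq_intros)
    ultimately have "((\<lambda>s. \<phi> (a + c * s)) has_real_derivative velocity \<phi> (a + c * s) * c) (at s)"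
      by (rule DERIV_chain2)
    from DERIV_cmult[OF this, of d] show ?thesis by (simp add: \<phi>(2) ac_simps)
  qed
  then have "\<forall>s\<in>K. (\<psi> has_vector_derivative d * c * velocity \<phi> (a + c * s)) (at s)"
    by (simp add: has_real_derivative_iff_has_vector_derivative)
  with smooth_curve_on_velocity[OF \<phi>(1)]
  show "\<exists>\<psi>'. (\<exists>d \<phi>. smooth_curve_on S \<phi> \<and> \<psi>' = (\<lambda>s. d * \<phi> (a + c * s))) \<and>
      (\<forall>s\<in>K. (\<psi> has_vector_derivative \<psi>' s) (at s))"
    by (intro exI[of _ "\<lambda>s. d * c * velocity \<phi> (a + c * s)"] exI[of _ "d * c"]
        exI[of _ "velocity \<phi>"] conjI refl)
qed

lemma smooth_curve_on_antiderivative: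
  assumes "open S" "smooth_curve_on S \<phi>"
    and "\<And>s. s \<in> S \<Longrightarrow> (\<psi> has_vector_derivative \<phi> s) (at s)"
  shows "smooth_curve_on S \<psi>"
\<comment> \<open>The single function \<open>\<psi>\<close> is adjoined to the smooth functions: one
  differentiation takes it to the smooth \<open>\<phi>\<close>.\<close>
proof (rule smooth_curve_on_coinduct[OF assms(1), where P = "\<lambda>\<omega>. smooth_curve_on S \<omega> \<or> \<omega> = \<psi>"])
  fix \<omega> assume "smooth_curve_on S \<omega> \<or> \<omega> = \<psi>"
  then show "\<exists>\<omega>'. (smooth_curve_on S \<omega>' \<or> \<omega>' = \<psi>) \<and>
      (\<forall>s\<in>S. (\<omega> has_vector_derivative \<omega>' s) (at s))"
  proof
    assume "smooth_curve_on S \<omega>"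
    then show ?thesis
      by (intro exI[of _ "velocity \<omega>"])
        (simp add: smooth_curve_on_velocity smooth_curve_on_has_derivative)
  next
    assume "\<omega> = \<psi>"
    then show ?thesis using assms(2,3) by (intro exI[of _ \<phi>]) simp
  qed
qed simp

lemma smooth_curve_on_pair:
  fixes \<phi> \<psi> :: "real \<Rightarrow> real"
  assumes "open S" "smooth_curve_on S \<phi>" "smooth_curve_on S \<psi>"
  shows "smooth_curve_on S (\<lambda>s. vector [\<phi> s, \<psi> s] :: real ^ 2)"
proof (rule smooth_curve_on_coinduct[OF assms(1), where P = "\<lambda>\<omega>. \<exists>\<phi> \<psi>. smooth_curve_on S \<phi> \<and>
    smooth_curve_on S \<psi> \<and> \<omega> = (\<lambda>s. vector [\<phi> s, \<psi> s] :: real ^ 2)"])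
  fix \<omega> :: "real \<Rightarrow> real ^ 2"
  assume "\<exists>\<phi> \<psi>. smooth_curve_on S \<phi> \<and> smooth_curve_on S \<psi> \<and> \<omega> = (\<lambda>s. vector [\<phi> s, \<psi> s])"
  then obtain \<phi> \<psi> where *: "smooth_curve_on S \<phi>" "smooth_curve_on S \<psi>"
    "\<omega> = (\<lambda>s. vector [\<phi> s, \<psi> s])" by blast
  have "\<forall>s\<in>S. (\<omega> has_vector_derivative vector [velocity \<phi> s, velocity \<psi> s]) (at s)"
    using smooth_curve_on_has_derivative[OF *(1)] smooth_curve_on_has_derivative[OF *(2)]
    by (simp add: has_vector_derivative_vec_iff forall_2
        has_real_derivative_iff_has_vector_derivative *(3))
  with smooth_curve_on_velocity[OF *(1)] smooth_curve_on_velocity[OF *(2)]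
  show "\<exists>\<omega>'. (\<exists>\<phi> \<psi>. smooth_curve_on S \<phi> \<and> smooth_curve_on S \<psi> \<and> \<omega>' = (\<lambda>s. vector [\<phi> s, \<psi> s])) \<and>
      (\<forall>s\<in>S. (\<omega> has_vector_derivative \<omega>' s) (at s))"
    by (intro exI[of _ "\<lambda>s. vector [velocity \<phi> s, velocity \<psi> s]"] exI[of _ "velocity \<phi>"]
        exI[of _ "velocity \<psi>"] conjI refl)
next
  show "\<exists>\<phi>' \<psi>'. smooth_curve_on S \<phi>' \<and> smooth_curve_on S \<psi>' \<and>
      (\<lambda>s. vector [\<phi> s, \<psi> s] :: real ^ 2) = (\<lambda>s. vector [\<phi>' s, \<psi>' s])"
    using assms(2,3) by (intro exI[of _ \<phi>] exI[of _ \<psi>] conjI refl)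
qed

lemma antiderivative_exists:
  fixes W :: "real \<Rightarrow> real"
  assumes "open K" "connected K" "continuous_on K W" "s0 \<in> K"
  shows "\<exists>V. V s0 = 0 \<and> (\<forall>s\<in>K. (V has_real_derivative W s) (at s))"
proof (intro exI[of _ "\<lambda>u::real. LBINT y=s0..u. W y"] conjI ballI)
  show "(LBINT y=s0..s0. W y) = 0" by simp
  fix s assume "s \<in> K"
  obtain e where e: "e > 0" "cball s e \<subseteq> K"
    using \<open>open K\<close> \<open>s \<in> K\<close> open_contains_cball by blast
  \<comment> \<open>This compact interval contains \<open>s0\<close> and a neighbourhood of
    \<open>s\<close>, so the derivative within it, given by the fundamental theorem, is a full
    derivative at \<open>s\<close>, on whichever side of \<open>s0\<close> that lies.\<close>
  let ?p = "min s0 (s - e)" and ?q = "max s0 (s + e)"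
  have "?p \<in> K" "?q \<in> K"
    using e \<open>s0 \<in> K\<close> by (auto simp: min_def max_def subset_iff dist_real_def)
  then have "{?p..?q} \<subseteq> K"
    using \<open>connected K\<close> by (metis connected_contains_Icc)
  then have "continuous_on {?p..?q} W"
    using assms(3) continuous_on_subset by blast
  then have "((\<lambda>u. LBINT y=s0..u. W y) has_vector_derivative W s) (at s within {?p..?q})"
    by (intro interval_integral_FTC2) (use e in auto)
  moreover have "at s within {?p..?q} = at s"
    by (intro at_within_interior) (use e in auto)
  ultimately show "((\<lambda>u. LBINT y=s0..u. W y) has_real_derivative W s) (at s)"
    by (simp add: has_real_derivative_iff_has_vector_derivative)
qed

subsection \<open>The induced metric of a rotational surface\<close>

text \<open>The coefficients \<open>G\<close> (as a function of the radius) and \<open>F\<close> of the induced metric.\<close>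

definition orbit_sq :: "real \<Rightarrow> real \<Rightarrow> real \<Rightarrow> real"
  where "orbit_sq l m r = (r / (1 + m * r\<^sup>2))\<^sup>2 + (l * r\<^sup>2 / (2 * (1 + m * r\<^sup>2)))\<^sup>2"

definition shear :: "real \<Rightarrow> real \<Rightarrow> (real \<Rightarrow> real) \<Rightarrow> (real \<Rightarrow> real) \<Rightarrow> real \<Rightarrow> real"
  where "shear l m f h u = - (l * (f u)\<^sup>2 / (2 * (1 + m * (f u)\<^sup>2))) * velocity h u"

section \<open>Bilinearity of the metric and projection orthogonal to the orbits\<close>

lemma bcv_metric_sym: "bcv_metric l m p a b = bcv_metric l m p b a"
  by (simp add: bcv_metric_def mult.commute)

lemma bcv_form_add: "bcv_form l m p (x *\<^sub>R a + y *\<^sub>R b) = x * bcv_form l m p a + y * bcv_form l m p b"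
  by (simp add: bcv_form_def algebra_simps add_divide_distrib diff_divide_distrib)

lemma bcv_metric_add:
  "bcv_metric l m p (x *\<^sub>R a + y *\<^sub>R b) c = x * bcv_metric l m p a c + y * bcv_metric l m p b c"
  by (simp add: bcv_metric_def bcv_form_add algebra_simps add_divide_distrib)

lemma bcv_metric_add_self:
  "bcv_metric l m p (x *\<^sub>R a + y *\<^sub>R b) (x *\<^sub>R a + y *\<^sub>R b) =
    x\<^sup>2 * bcv_metric l m p a a + 2 * x * y * bcv_metric l m p a b + y\<^sup>2 * bcv_metric l m p b b"
  using bcv_metric_sym[of l m p]
  by (simp add: bcv_metric_add bcv_metric_sym[of l m p _ "x *\<^sub>R a + y *\<^sub>R b"] algebra_simps
      power2_eq_square)

text \<open>Removing the component along \<open>X\<close> leaves squared length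
  \<open>E - F^2 / G\<close>, where \<open>E\<close>, \<open>F\<close>, \<open>G\<close> are the
  products of \<open>a\<close> and \<open>X\<close>. Setting this to 1 and multiplying by
  \<open>G\<close> gives the identity.\<close>

lemma orbit_space_norm_eq_1:
  assumes "orbit_space_norm l m p a = 1" and "bcv_metric l m p (rot_field p) (rot_field p) \<noteq> 0"
  shows "bcv_metric l m p a a * bcv_metric l m p (rot_field p) (rot_field p)
    - (bcv_metric l m p a (rot_field p))\<^sup>2 = bcv_metric l m p (rot_field p) (rot_field p)"
proof -
  let ?X = "rot_field p"
  let ?c = "bcv_metric l m p a ?X / bcv_metric l m p ?X ?X"
  \<comment> \<open>The scalars \<open>1\<close> and \<open>- ?c\<close> put the orthogonal part
    into the shape that \<open>bcv_metric_add_self\<close> expands.\<close>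
  have "bcv_metric l m p (1 *\<^sub>R a + (- ?c) *\<^sub>R ?X) (1 *\<^sub>R a + (- ?c) *\<^sub>R ?X) = 1"
    using assms(1) by (simp add: orbit_space_norm_def bcv_norm_def orbit_orthogonal_part_def)
  then show ?thesis
    unfolding bcv_metric_add_self using assms(2) by (simp add: field_simps power2_eq_square)
qed

section \<open>Coordinate fields and the metric coefficients in \<open>(u, v)\<close>\<close>

lemma pderiv_coord_rot_param_2: "pderiv_coord 2 (rot_param f h) q = rot_field (rot_param f h q)"
  unfolding pderiv_coord_def
  by (rule vector_derivative_at)
    (auto simp: has_vector_derivative_vec_iff forall_3 rot_param_def rot_field_def axis_def
      intro!: derivative_eq_intros)

lemma pderiv_coord_rot_param_1:
  assumes "(f has_real_derivative f') (at (q $ 1))" "(h has_real_derivative h') (at (q $ 1))"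
  shows "pderiv_coord 1 (rot_param f h) q = vector [f' * cos (q $ 2), f' * sin (q $ 2), h']"
proof -
  have *: "((\<lambda>t. \<phi> (q $ 1 + t)) has_real_derivative d) (at 0)"
    if "(\<phi> has_real_derivative d) (at (q $ 1))" for \<phi> :: "real \<Rightarrow> real" and d
    using DERIV_shift[of \<phi> d 0 "q $ 1"] that by (simp add: add.commute)
  show ?thesis
    unfolding pderiv_coord_def
    by (rule vector_derivative_at)
      (auto simp: has_vector_derivative_vec_iff forall_3 rot_param_def axis_def
        intro!: derivative_eq_intros *[OF assms(1)] *[OF assms(2)])
qed

lemma bcv_factor_rot_param: "bcv_factor m (rot_param f h q) = 1 + m * (f (q $ 1))\<^sup>2"
proof -
  have "(f (q $ 1) * cos (q $ 2))\<^sup>2 + (f (q $ 1) * sin (q $ 2))\<^sup>2 =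
      (f (q $ 1))\<^sup>2 * ((cos (q $ 2))\<^sup>2 + (sin (q $ 2))\<^sup>2)"
    by algebra
  then show ?thesis by (simp add: bcv_factor_def rot_param_def)
qed

lemma bcv_form_rot_field:
  "bcv_form l m (rot_param f h q) (rot_field (rot_param f h q)) =
    - (l * (f (q $ 1))\<^sup>2 / (2 * (1 + m * (f (q $ 1))\<^sup>2)))"
proof -
  have "- (f (q $ 1) * sin (q $ 2) * (f (q $ 1) * sin (q $ 2)))
      - f (q $ 1) * cos (q $ 2) * (f (q $ 1) * cos (q $ 2))
      = - ((f (q $ 1))\<^sup>2 * ((cos (q $ 2))\<^sup>2 + (sin (q $ 2))\<^sup>2))"
    by algebra
  then show ?thesis
    unfolding bcv_form_def bcv_factor_rot_param
    by (simp add: rot_param_def rot_field_def)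
qed

lemma bcv_metric_rot_field:
  "bcv_metric l m (rot_param f h q) (rot_field (rot_param f h q)) (rot_field (rot_param f h q)) =
    orbit_sq l m (f (q $ 1))"
proof -
  have "f (q $ 1) * sin (q $ 2) * (f (q $ 1) * sin (q $ 2))
      + f (q $ 1) * cos (q $ 2) * (f (q $ 1) * cos (q $ 2))
      = (f (q $ 1))\<^sup>2 * ((cos (q $ 2))\<^sup>2 + (sin (q $ 2))\<^sup>2)"
    by algebra
  then show ?thesis
    unfolding bcv_metric_def bcv_form_rot_field bcv_factor_rot_param orbit_sq_def
    by (simp add: rot_param_def rot_field_def power_divide power2_eq_square)
qed

text \<open>The horizontal part of this tangent vector is radial, and \<open>y dx - x dy\<close>
  vanishes on radial vectors.\<close>

lemma bcv_form_meridian: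
  "bcv_form l m (rot_param f h q) (vector [f' * cos (q $ 2), f' * sin (q $ 2), h']) = h'"
  by (simp add: bcv_form_def rot_param_def)

text \<open>Radial and angular directions are Euclidean orthogonal, so only the product of the two
  values of \<open>bcv_form\<close> survives.\<close>

lemma bcv_metric_meridian_rot_field:
  "bcv_metric l m (rot_param f h q) (vector [f' * cos (q $ 2), f' * sin (q $ 2), h'])
      (rot_field (rot_param f h q)) =
    - (l * (f (q $ 1))\<^sup>2 / (2 * (1 + m * (f (q $ 1))\<^sup>2))) * h'"
  unfolding bcv_metric_def bcv_form_rot_field bcv_form_meridian
  by (simp add: rot_param_def rot_field_def)

lemma bcv_metric_meridian:
  "bcv_metric l m (rot_param f h q) (vector [f' * cos (q $ 2), f' * sin (q $ 2), h'])
      (vector [f' * cos (q $ 2), f' * sin (q $ 2), h']) =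
    (f' / (1 + m * (f (q $ 1))\<^sup>2))\<^sup>2 + h'\<^sup>2"
proof -
  have "f' * cos (q $ 2) * (f' * cos (q $ 2)) + f' * sin (q $ 2) * (f' * sin (q $ 2))
      = f'\<^sup>2 * ((cos (q $ 2))\<^sup>2 + (sin (q $ 2))\<^sup>2)"
    by algebra
  then show ?thesis
    unfolding bcv_metric_def bcv_form_meridian bcv_factor_rot_param
    by (simp add: power_divide power2_eq_square)
qed

lemma rotational_surface_has_derivative:
  assumes "rotational_surface l m I f h" "u \<in> I"
  shows "(f has_real_derivative velocity f u) (at u)" "(h has_real_derivative velocity h u) (at u)"
  using assms smooth_curve_on_has_derivative
  by (auto simp: rotational_surface_def has_real_derivative_iff_has_vector_derivative)

text \<open>Rotations are isometries, so the entries see only \<open>u = q $ 1\<close>; the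
  vanishing of the \<open>v\<close>-derivatives of the metric in \<open>clairaut\<close> comes from
  here.\<close>

lemma first_fundamental_form_rotational:
  assumes "rotational_surface l m I f h" "q $ 1 \<in> I"
  shows "first_fundamental_form l m f h q $ 1 $ 1 =
      (velocity f (q $ 1) / (1 + m * (f (q $ 1))\<^sup>2))\<^sup>2 + (velocity h (q $ 1))\<^sup>2"
    and "first_fundamental_form l m f h q $ 1 $ 2 = shear l m f h (q $ 1)"
    and "first_fundamental_form l m f h q $ 2 $ 1 = shear l m f h (q $ 1)"
    and "first_fundamental_form l m f h q $ 2 $ 2 = orbit_sq l m (f (q $ 1))"
  using pderiv_coord_rot_param_1[OF rotational_surface_has_derivative[OF assms]]
  by (simp_all add: first_fundamental_form_def pderiv_coord_rot_param_2 bcv_metric_rot_field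
      bcv_metric_meridian bcv_metric_meridian_rot_field shear_def
      bcv_metric_sym[of l m _ "rot_field _" "vector _"])

lemma rotational_surface_factor_pos:
  assumes "rotational_surface l m I f h" "u \<in> I"
  shows "1 + m * (f u)\<^sup>2 > 0"
proof -
  \<comment> \<open>Any angle represents the orbit of parameter \<open>u\<close>;
    \<open>axis 1 u\<close> is the point \<open>(u, 0)\<close>.\<close>
  define q :: "real ^ 2" where "q = axis 1 u"
  have "rot_param f h q \<in> bcv_domain m"
    using assms by (simp add: rotational_surface_def q_def axis_def)
  then have dom: "m < 0 \<Longrightarrow> (f u)\<^sup>2 < - 1 / m"
    by (simp add: bcv_domain_def rot_param_def q_def axis_def split: if_splits)
  show ?thesis
  proof (cases "m < 0")
    case True
    \<comment> \<open>Multiplying \<open>(f u)\<^sup>2 < - 1 / m\<close> by the negative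
      \<open>m\<close> gives \<open>m * (f u)\<^sup>2 > - 1\<close>.\<close>
    from mult_strict_left_mono_neg[OF dom[OF True] True] True show ?thesis by simp
  next
    case False
    then show ?thesis by (intro add_pos_nonneg mult_nonneg_nonneg) auto
  qed
qed

lemma rotational_surface_orbit_sq_pos:
  assumes "rotational_surface l m I f h" "u \<in> I"
  shows "orbit_sq l m (f u) > 0"
proof -
  have "f u / (1 + m * (f u)\<^sup>2) > 0"
    using rotational_surface_factor_pos[OF assms] assms by (simp add: rotational_surface_def)
  then show ?thesis unfolding orbit_sq_def by (intro add_pos_nonneg) auto
qed

text \<open>This is the arc-length condition on the orbit space, read in coordinates. It serves
  twice: the determinant of the metric is the positive number \<open>G\<close>, and \<open>E\<close>
  can be eliminated from the unit-speed condition.\<close>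

lemma first_fundamental_form_det:
  assumes "rotational_surface l m I f h" "q $ 1 \<in> I"
  shows "first_fundamental_form l m f h q $ 1 $ 1 * orbit_sq l m (f (q $ 1))
    - (shear l m f h (q $ 1))\<^sup>2 = orbit_sq l m (f (q $ 1))"
proof -
  let ?p = "rot_param f h q"
  let ?a = "pderiv_coord 1 (rot_param f h) q"
  have "orbit_space_norm l m ?p ?a = 1"
    using assms by (simp add: rotational_surface_def)
  from orbit_space_norm_eq_1[OF this]
  have "bcv_metric l m ?p ?a ?a * orbit_sq l m (f (q $ 1)) - (bcv_metric l m ?p ?a (rot_field ?p))\<^sup>2
      = orbit_sq l m (f (q $ 1))"
    using rotational_surface_orbit_sq_pos[OF assms] by (simp add: bcv_metric_rot_field)
  moreover have "bcv_metric l m ?p ?a (rot_field ?p) = shear l m f h (q $ 1)"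
    using first_fundamental_form_rotational(2)[OF assms]
    by (simp add: first_fundamental_form_def pderiv_coord_rot_param_2)
  ultimately show ?thesis by (simp add: first_fundamental_form_def)
qed


section \<open>Regularity and level sets of the metric coefficients\<close>

lemma smooth_curve_on_shear_orbit_sq:
  assumes "rotational_surface l m I f h"
  shows "smooth_curve_on I (shear l m f h)" "smooth_curve_on I (\<lambda>u. orbit_sq l m (f u))"
proof -
  have I: "open I" and f: "f \<in> smooth_closure I" and h: "velocity h \<in> smooth_closure I"
    using assms smooth_closure_iff
    by (auto simp: rotational_surface_def smooth_curve_on_velocity)
  note closure = f h smooth_closure_const[OF I] smooth_closure_uminus[OF I] smooth_closure_power2
    smooth_closure_divide smooth_closure.mult smooth_closure.add
  have "(\<lambda>u. - (l * (f u)\<^sup>2 / (2 * (1 + m * (f u)\<^sup>2))) * velocity h u) \<in> smooth_closure I"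
    using rotational_surface_factor_pos[OF assms] by (intro closure) force
  then show "smooth_curve_on I (shear l m f h)"
    unfolding shear_def[abs_def] by (simp only: smooth_closure_iff[OF I])
  have "(\<lambda>u. (f u / (1 + m * (f u)\<^sup>2))\<^sup>2 + (l * (f u)\<^sup>2 / (2 * (1 + m * (f u)\<^sup>2)))\<^sup>2)
      \<in> smooth_closure I"
    using rotational_surface_factor_pos[OF assms] by (intro closure) force+
  then show "smooth_curve_on I (\<lambda>u. orbit_sq l m (f u))"
    unfolding orbit_sq_def by (simp only: smooth_closure_iff[OF I])
qed

text \<open>Clearing denominators turns the level equation into a polynomial equation in
  \<open>r\<close> whose constant coefficient \<open>- c\<close> keeps it nontrivial for all
  \<open>l\<close> and \<open>m\<close>.\<close>

lemma finite_orbit_sq_level: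
  assumes "c \<noteq> 0"
  shows "finite {r. 1 + m * r\<^sup>2 \<noteq> 0 \<and> orbit_sq l m r = c}"
proof -
  \<comment> \<open>Coefficients, in ascending order, of \<open>r\<^sup>2 + l\<^sup>2 * r^4 / 4 - c
    * (1 + m * r\<^sup>2)\<^sup>2\<close>.\<close>
  let ?p = "[:- c, 0, 1 - 2 * c * m, 0, l\<^sup>2 / 4 - c * m\<^sup>2:]"
  have "poly ?p r = 0" if "1 + m * r\<^sup>2 \<noteq> 0" "orbit_sq l m r = c" for r
  proof -
    define B where "B = 1 + m * r\<^sup>2"
    have "B \<noteq> 0" "c = (r / B)\<^sup>2 + (l * r\<^sup>2 / (2 * B))\<^sup>2"
      using that by (simp_all add: B_def orbit_sq_def)
    then have "c * B\<^sup>2 = r\<^sup>2 + (l * r\<^sup>2 / 2)\<^sup>2"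
      by (simp add: field_simps power2_eq_square)
    then show ?thesis unfolding B_def by (simp add: algebra_simps power2_eq_square)
  qed
  then have "{r. 1 + m * r\<^sup>2 \<noteq> 0 \<and> orbit_sq l m r = c} \<subseteq> {r. poly ?p r = 0}" by blast
  moreover have "?p \<noteq> 0" using assms by simp
  ultimately show ?thesis by (rule finite_subset[OF _ poly_roots_finite])
qed

subsection \<open>Loxodromes and the Clairaut relation\<close>

lemma velocity_rot_param_comp:
  assumes "rotational_surface l m I f h" "\<gamma> s $ 1 \<in> I" "(\<gamma> has_vector_derivative d) (at s)"
  shows "velocity (rot_param f h \<circ> \<gamma>) s =
    d $ 1 *\<^sub>R pderiv_coord 1 (rot_param f h) (\<gamma> s) + d $ 2 *\<^sub>R rot_field (rot_param f h (\<gamma> s))"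
proof -
  note fh = rotational_surface_has_derivative[OF assms(1,2)]
  have d: "((\<lambda>t. \<gamma> t $ i) has_real_derivative d $ i) (at s)" for i
    using assms(3) by (simp add: has_vector_derivative_vec_iff)
  note [derivative_intros] = DERIV_chain2[OF fh(1) d] DERIV_chain2[OF fh(2) d] d
  show ?thesis
    unfolding pderiv_coord_rot_param_1[OF fh]
    by (rule vector_derivative_at)
      (auto simp: has_vector_derivative_vec_iff forall_3 rot_param_def rot_field_def
        intro!: derivative_eq_intros)
qed

text \<open>Unit speed multiplied by \<open>G\<close> reads
  \<open>G u'^2 + (F u' + G v')^2 = G\<close>, since \<open>E G = G + F^2\<close>. The angle
  condition fixes the second square as \<open>G (cos \<theta>)^2\<close>, which leaves
  \<open>u'^2 = (sin \<theta>)^2\<close>. The converse is what certifies the extended curve in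
  \<open>loxodrome_extends\<close>.\<close>

lemma loxodrome_condition_iff:
  assumes "rotational_surface l m I f h" "\<gamma> s $ 1 \<in> I" "(\<gamma> has_vector_derivative d) (at s)"
  defines "p \<equiv> (rot_param f h \<circ> \<gamma>) s" and "a \<equiv> velocity (rot_param f h \<circ> \<gamma>) s"
  shows "bcv_norm l m p a = 1 \<and>
      bcv_metric l m p a (rot_field p) = bcv_norm l m p (rot_field p) * cos \<theta> \<longleftrightarrow>
    shear l m f h (\<gamma> s $ 1) * d $ 1 + orbit_sq l m (f (\<gamma> s $ 1)) * d $ 2 =
      sqrt (orbit_sq l m (f (\<gamma> s $ 1))) * cos \<theta> \<and> (d $ 1)\<^sup>2 = (sin \<theta>)\<^sup>2"
proof -
  define X where "X = rot_field p"
  define e where "e = pderiv_coord 1 (rot_param f h) (\<gamma> s)"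
  define G where "G = orbit_sq l m (f (\<gamma> s $ 1))"
  define F where "F = shear l m f h (\<gamma> s $ 1)"
  have a: "a = d $ 1 *\<^sub>R e + d $ 2 *\<^sub>R X"
    using velocity_rot_param_comp[OF assms(1,2,3)] by (simp add: a_def e_def X_def p_def)
  have G: "G > 0" "bcv_metric l m p X X = G"
    using rotational_surface_orbit_sq_pos[OF assms(1,2)]
    by (simp_all add: G_def X_def p_def bcv_metric_rot_field)
  have F: "bcv_metric l m p e X = F"
    using first_fundamental_form_rotational(2)[OF assms(1,2)]
    by (simp add: F_def first_fundamental_form_def pderiv_coord_rot_param_2 X_def e_def p_def)
  have E: "bcv_metric l m p e e * G - F\<^sup>2 = G"
    using first_fundamental_form_det[OF assms(1,2)]
    by (simp add: F_def G_def first_fundamental_form_def e_def p_def)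
  have aX: "bcv_metric l m p a X = F * d $ 1 + G * d $ 2"
    by (simp add: a bcv_metric_add F G mult.commute)
  \<comment> \<open>Completing the square in \<open>v'\<close> after multiplication by
    \<open>G\<close>.\<close>
  have "bcv_metric l m p a a * G = G * (d $ 1)\<^sup>2 + (F * d $ 1 + G * d $ 2)\<^sup>2"
  proof -
    have aa: "bcv_metric l m p a a * G = (d $ 1)\<^sup>2 * (bcv_metric l m p e e * G) +
        2 * d $ 1 * d $ 2 * F * G + (d $ 2 * G)\<^sup>2"
      unfolding a bcv_metric_add_self F G(2) by (simp add: algebra_simps power2_eq_square)
    have ee: "bcv_metric l m p e e * G = G + F\<^sup>2" using E by simp
    show ?thesis unfolding aa ee by (simp add: algebra_simps power2_eq_square)
  qed
  then have aa: "bcv_metric l m p a a = 1 \<longleftrightarrow> G * (d $ 1)\<^sup>2 + (F * d $ 1 + G * d $ 2)\<^sup>2 = G"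
    using G(1) by (metis less_irrefl mult_cancel_right2)
  have "G * (d $ 1)\<^sup>2 + (sqrt G * cos \<theta>)\<^sup>2 = G \<longleftrightarrow> (d $ 1)\<^sup>2 = (sin \<theta>)\<^sup>2"
  proof -
    have "G * (d $ 1)\<^sup>2 + (sqrt G * cos \<theta>)\<^sup>2 = G * ((d $ 1)\<^sup>2 + (cos \<theta>)\<^sup>2)"
      using G(1) by (simp add: power_mult_distrib distrib_left)
    then have "G * (d $ 1)\<^sup>2 + (sqrt G * cos \<theta>)\<^sup>2 = G \<longleftrightarrow> (d $ 1)\<^sup>2 + (cos \<theta>)\<^sup>2 = 1"
      using G(1) by simp
    then show ?thesis using sin_cos_squared_add[of \<theta>] by linarith
  qed
  then show ?thesis
    using aX aa G(2) unfolding bcv_norm_def X_def[symmetric] G_def[symmetric] F_def[symmetric]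
    by auto
qed

text \<open>Lowering the index of the geodesic equation eliminates the inverse metric.\<close>

lemma geodesic_on_lowered:
  fixes g :: "real ^ 'n \<Rightarrow> real ^ 'n ^ 'n" and \<gamma> :: "real \<Rightarrow> real ^ 'n"
  assumes "geodesic_on g J \<gamma>" "s \<in> J" "invertible (g (\<gamma> s))"
  shows "(\<Sum>k\<in>UNIV. g (\<gamma> s) $ r $ k * velocity (velocity \<gamma>) s $ k) +
    (\<Sum>i\<in>UNIV. \<Sum>j\<in>UNIV. (pderiv_coord i (\<lambda>x. g x $ j $ r) (\<gamma> s) +
        pderiv_coord j (\<lambda>x. g x $ i $ r) (\<gamma> s) - pderiv_coord r (\<lambda>x. g x $ i $ j) (\<gamma> s)) / 2 *
      velocity \<gamma> s $ i * velocity \<gamma> s $ j) = 0"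
proof -
  define A where "A = g (\<gamma> s)"
  define D where "D i j r = pderiv_coord i (\<lambda>x. g x $ j $ r) (\<gamma> s) +
    pderiv_coord j (\<lambda>x. g x $ i $ r) (\<gamma> s) - pderiv_coord r (\<lambda>x. g x $ i $ j) (\<gamma> s)" for i j r
  define w where "w = velocity \<gamma> s"
  \<comment> \<open>\<open>matrix_inv\<close> is a choice among two-sided inverses; contracting with
    \<open>A\<close> from the left uses the right-inverse half.\<close>
  have "A ** matrix_inv A = mat 1"
    using assms(3) unfolding A_def invertible_def matrix_inv_def by (rule someI2_ex) simp
  then have inv: "(\<Sum>k\<in>UNIV. A $ r $ k * matrix_inv A $ k $ t) = (if r = t then 1 else 0)" for t
    by (simp add: matrix_matrix_mult_def mat_def vec_eq_iff)
  have low: "(\<Sum>k\<in>UNIV. A $ r $ k * christoffel g (\<gamma> s) k i j) = D i j r / 2" for i j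
  proof -
    have "(\<Sum>k\<in>UNIV. A $ r $ k * christoffel g (\<gamma> s) k i j) =
        (\<Sum>k\<in>UNIV. \<Sum>t\<in>UNIV. A $ r $ k * matrix_inv A $ k $ t * (D i j t / 2))"
      by (simp add: christoffel_def A_def D_def sum_distrib_left mult.assoc)
    also have "\<dots> = (\<Sum>t\<in>UNIV. (\<Sum>k\<in>UNIV. A $ r $ k * matrix_inv A $ k $ t) * (D i j t / 2))"
      by (subst sum.swap) (simp only: sum_distrib_right)
    also have "\<dots> = (\<Sum>t\<in>UNIV. if r = t then D i j t / 2 else 0)"
      unfolding inv by (intro sum.cong refl) simp
    also have "\<dots> = D i j r / 2" by simp
    finally show ?thesis .
  qed
  have "0 = (\<Sum>k\<in>UNIV. A $ r $ k * (velocity (velocity \<gamma>) s $ k +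
      (\<Sum>i\<in>UNIV. \<Sum>j\<in>UNIV. christoffel g (\<gamma> s) k i j * w $ i * w $ j)))"
    using assms(1,2) by (simp add: geodesic_on_def w_def)
  also have "\<dots> = (\<Sum>k\<in>UNIV. A $ r $ k * velocity (velocity \<gamma>) s $ k) +
      (\<Sum>k\<in>UNIV. \<Sum>i\<in>UNIV. \<Sum>j\<in>UNIV. A $ r $ k * christoffel g (\<gamma> s) k i j * w $ i * w $ j)"
    by (simp add: distrib_left sum.distrib sum_distrib_left mult.assoc)
  \<comment> \<open>Two interchanges bring the sum over \<open>k\<close> innermost, where
    \<open>low\<close> contracts it.\<close>
  also have "(\<Sum>k\<in>UNIV. \<Sum>i\<in>UNIV. \<Sum>j\<in>UNIV. A $ r $ k * christoffel g (\<gamma> s) k i j * w $ i * w $ j) =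
      (\<Sum>i\<in>UNIV. \<Sum>k\<in>UNIV. \<Sum>j\<in>UNIV. A $ r $ k * christoffel g (\<gamma> s) k i j * w $ i * w $ j)"
    by (rule sum.swap)
  also have "\<dots> =
      (\<Sum>i\<in>UNIV. \<Sum>j\<in>UNIV. \<Sum>k\<in>UNIV. A $ r $ k * christoffel g (\<gamma> s) k i j * w $ i * w $ j)"
    by (intro sum.cong refl sum.swap)
  also have "\<dots> = (\<Sum>i\<in>UNIV. \<Sum>j\<in>UNIV. D i j r / 2 * w $ i * w $ j)"
    by (simp only: low sum_distrib_right[symmetric])
  finally show ?thesis by (simp add: A_def D_def w_def)
qed

text \<open>Openness of \<open>I\<close> keeps small shifts in the first direction inside the strip
  where \<open>F\<close> is known; shifts in the second leave \<open>\<phi> (q $ 1)\<close>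
  unchanged. Smoothness is a premise of the first conclusion alone, so the second applies to the
  entry \<open>E\<close> directly.\<close>

lemma pderiv_coord_fst:
  fixes F :: "real ^ 2 \<Rightarrow> real"
  assumes "open I" "q $ 1 \<in> I" "\<And>x. x $ 1 \<in> I \<Longrightarrow> F x = \<phi> (x $ 1)"
  shows "smooth_curve_on I \<phi> \<Longrightarrow> pderiv_coord 1 F q = velocity \<phi> (q $ 1)" "pderiv_coord 2 F q = 0"
proof -
  assume "smooth_curve_on I \<phi>"
  from smooth_curve_on_has_derivative[OF this assms(2)]
  have "(\<phi> has_real_derivative velocity \<phi> (q $ 1)) (at (0 + q $ 1))"
    by (simp add: has_real_derivative_iff_has_vector_derivative)
  then have "((\<lambda>t. \<phi> (t + q $ 1)) has_real_derivative velocity \<phi> (q $ 1)) (at 0)"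
    unfolding DERIV_shift .
  then have "((\<lambda>t. \<phi> (t + q $ 1)) has_vector_derivative velocity \<phi> (q $ 1)) (at 0)"
    by (simp only: has_real_derivative_iff_has_vector_derivative)
  moreover have "open ((\<lambda>t. t + q $ 1) -` I)"
    using assms(1) by (intro open_vimage continuous_intros)
  ultimately have "((\<lambda>t. F (q + t *\<^sub>R axis 1 1)) has_vector_derivative velocity \<phi> (q $ 1)) (at 0)"
    by (rule has_vector_derivative_transform_within_open)
      (use assms(2,3) in \<open>auto simp: axis_def add.commute\<close>)
  then show "pderiv_coord 1 F q = velocity \<phi> (q $ 1)"
    unfolding pderiv_coord_def by (rule vector_derivative_at)
next
  have "(\<lambda>t. F (q + t *\<^sub>R axis 2 1)) = (\<lambda>t. \<phi> (q $ 1))"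
    using assms(2,3) by (auto simp: axis_def)
  then show "pderiv_coord 2 F q = 0" by (simp add: pderiv_coord_def)
qed

text \<open>The metric does not depend on \<open>v\<close>, so the rotation is a symmetry and the
  momentum \<open>F u' + G v'\<close> of a geodesic is conserved.\<close>

lemma clairaut:
  assumes surf: "rotational_surface l m I f h" and smooth: "smooth_curve_on J \<gamma>"
    and geo: "geodesic_on (first_fundamental_form l m f h) J \<gamma>" and "s \<in> J" and "\<gamma> s $ 1 \<in> I"
  shows "((\<lambda>s. shear l m f h (\<gamma> s $ 1) * velocity \<gamma> s $ 1 +
    orbit_sq l m (f (\<gamma> s $ 1)) * velocity \<gamma> s $ 2) has_real_derivative 0) (at s)"
proof -
  let ?g = "first_fundamental_form l m f h"
  let ?F = "shear l m f h" and ?G = "\<lambda>u. orbit_sq l m (f u)"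
  define u where "u = \<gamma> s $ 1"
  define w where "w = velocity \<gamma> s"
  define w' where "w' = velocity (velocity \<gamma>) s"
  have I: "open I" using surf by (simp add: rotational_surface_def)
  have "u \<in> I" using assms by (simp add: u_def)
  note FG = smooth_curve_on_shear_orbit_sq[OF surf]
  note g = first_fundamental_form_rotational[OF surf]
  note pd = pderiv_coord_fst[OF I \<open>\<gamma> s $ 1 \<in> I\<close>]
  have "det (?g (\<gamma> s)) \<noteq> 0"
    using first_fundamental_form_det[OF surf assms(5)]
      rotational_surface_orbit_sq_pos[OF surf assms(5)]
    by (simp add: det_2 g(2,3,4)[OF assms(5)] power2_eq_square)
  then have inv: "invertible (?g (\<gamma> s))" by (simp add: invertible_det_nz)
  \<comment> \<open>In the lowered equation with index 2, derivatives in \<open>u\<close> fall only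
    on the entries \<open>F\<close> and \<open>G\<close>.\<close>
  have pd1: "pderiv_coord 1 (\<lambda>x. ?g x $ 1 $ 2) (\<gamma> s) = velocity ?F u"
    "pderiv_coord 1 (\<lambda>x. ?g x $ 2 $ 2) (\<gamma> s) = velocity ?G u"
    unfolding u_def by (rule pd(1)[OF g(2) FG(1)] pd(1)[OF g(4) FG(2)]; assumption)+
  have pd2: "pderiv_coord 2 (\<lambda>x. ?g x $ 1 $ 1) (\<gamma> s) = 0"
    "pderiv_coord 2 (\<lambda>x. ?g x $ 1 $ 2) (\<gamma> s) = 0"
    "pderiv_coord 2 (\<lambda>x. ?g x $ 2 $ 1) (\<gamma> s) = 0"
    "pderiv_coord 2 (\<lambda>x. ?g x $ 2 $ 2) (\<gamma> s) = 0"
       apply (rule pd(2)[where \<phi> = "\<lambda>u. (velocity f u / (1 + m * (f u)\<^sup>2))\<^sup>2 + (velocity h u)\<^sup>2"],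
        rule g(1), assumption)
      apply (rule pd(2)[where \<phi> = ?F], rule g(2), assumption)
     apply (rule pd(2)[where \<phi> = ?F], rule g(3), assumption)
    apply (rule pd(2)[where \<phi> = ?G], rule g(4), assumption)
    done
  \<comment> \<open>With all \<open>v\<close>-derivatives zero, the left side is the total
    derivative of \<open>F u' + G v'\<close> along the curve.\<close>
  have eq: "?F u * w' $ 1 + ?G u * w' $ 2 + velocity ?F u * (w $ 1)\<^sup>2 +
      velocity ?G u * w $ 1 * w $ 2 = 0"
    using geodesic_on_lowered[OF geo \<open>s \<in> J\<close> inv, of 2]
    by (simp add: sum_2 pd1 pd2 g(3,4)[OF assms(5)] u_def[symmetric] w_def[symmetric]
        w'_def[symmetric] power2_eq_square algebra_simps)
  have d1: "((\<lambda>t. \<gamma> t $ i) has_real_derivative w $ i) (at s)" for i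
    using smooth_curve_on_has_derivative[OF smooth \<open>s \<in> J\<close>]
    by (simp add: has_vector_derivative_vec_iff w_def)
  have d2: "((\<lambda>t. velocity \<gamma> t $ i) has_real_derivative w' $ i) (at s)" for i
    using smooth_curve_on_has_derivative[OF smooth_curve_on_velocity[OF smooth] \<open>s \<in> J\<close>]
    by (simp add: has_vector_derivative_vec_iff w'_def)
  have dF: "(?F has_real_derivative velocity ?F u) (at (\<gamma> s $ 1))"
    and dG: "(?G has_real_derivative velocity ?G u) (at (\<gamma> s $ 1))"
    using smooth_curve_on_has_derivative[OF FG(1) \<open>u \<in> I\<close>]
      smooth_curve_on_has_derivative[OF FG(2) \<open>u \<in> I\<close>]
    by (simp_all add: has_real_derivative_iff_has_vector_derivative u_def)
  from DERIV_add[OF DERIV_mult[OF DERIV_chain2[OF dF d1] d2] DERIV_mult[OF DERIV_chain2[OF dG d1] d2],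
      of 1 2]
  show ?thesis
    by (rule DERIV_cong)
      (use eq in \<open>simp add: u_def[symmetric] w_def[symmetric] power2_eq_square algebra_simps\<close>)
qed

text \<open>Constant \<open>u'\<close> makes \<open>u\<close> affine, so the loxodrome equation
  gives \<open>v'\<close> as an explicit function of \<open>s\<close> and a quadrature produces the
  extension. As \<open>c \<noteq> 0\<close>, the affine \<open>u\<close> sweeps out all of
  \<open>I\<close>.\<close>

lemma loxodrome_extends:
  assumes surf: "rotational_surface l m I f h" and lox: "loxodrome l m I f h \<theta> J \<gamma>"
    and c: "c \<noteq> 0" "c\<^sup>2 = (sin \<theta>)\<^sup>2" "\<And>s. s \<in> J \<Longrightarrow> velocity \<gamma> s $ 1 = c"
  shows "\<exists>K \<beta>. loxodrome l m I f h \<theta> K \<beta> \<and> J \<subseteq> K \<and> (\<forall>s\<in>J. \<beta> s = \<gamma> s) \<and> (\<lambda>s. \<beta> s $ 1) ` K = I"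
proof -
  let ?F = "shear l m f h" and ?G = "\<lambda>u. orbit_sq l m (f u)"
  have I: "open I" "connected I" using surf by (auto simp: rotational_surface_def)
  have J: "open J" "connected J" "J \<noteq> {}" and smooth: "smooth_curve_on J \<gamma>"
    and JI: "\<And>s. s \<in> J \<Longrightarrow> \<gamma> s $ 1 \<in> I"
    using lox by (auto simp: loxodrome_def)
  have d: "(\<gamma> has_vector_derivative velocity \<gamma> s) (at s)" if "s \<in> J" for s
    by (rule smooth_curve_on_has_derivative[OF smooth that])
  have speed: "?F (\<gamma> s $ 1) * c + ?G (\<gamma> s $ 1) * velocity \<gamma> s $ 2 = sqrt (?G (\<gamma> s $ 1)) * cos \<theta>"
    if "s \<in> J" for s
    using lox that loxodrome_condition_iff[OF surf JI[OF that] d[OF that], of \<theta>] c(3)[OF that]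
    by (simp add: loxodrome_def Let_def)
  obtain s0 where s0: "s0 \<in> J" using J by blast
  \<comment> \<open>Normalized so that \<open>b + c * s0\<close> is the value of \<open>u\<close> at
    \<open>s0\<close>.\<close>
  define b where "b = \<gamma> s0 $ 1 - c * s0"
  have u: "\<gamma> s $ 1 = b + c * s" if "s \<in> J" for s
  proof -
    have "((\<lambda>s. \<gamma> s $ 1 - (b + c * s)) has_real_derivative 0) (at t)" if "t \<in> J" for t
      using d[OF that] c(3)[OF that] unfolding has_vector_derivative_vec_iff
      by (auto intro!: derivative_eq_intros)
    then have "(\<lambda>s. \<gamma> s $ 1 - (b + c * s)) constant_on J"
      using J by (intro has_field_derivative_0_imp_constant_on)
    then have "\<gamma> s $ 1 - (b + c * s) = \<gamma> s0 $ 1 - (b + c * s0)"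
      using that s0 unfolding constant_on_def by metis
    then show ?thesis by (simp add: b_def)
  qed
  \<comment> \<open>The largest parameter set on which the affine \<open>u\<close> stays in
    \<open>I\<close>.\<close>
  define K where "K = (\<lambda>s. b + c * s) -` I"
  have K: "open K" unfolding K_def using I by (intro open_vimage continuous_intros)
  have img: "(\<lambda>s. b + c * s) ` K = I"
  proof
    show "I \<subseteq> (\<lambda>s. b + c * s) ` K"
    proof
      fix x assume "x \<in> I"
      then show "x \<in> (\<lambda>s. b + c * s) ` K"
        using c(1) by (intro image_eqI[of _ _ "(x - b) / c"]) (auto simp: K_def)
    qed
  qed (auto simp: K_def)
  \<comment> \<open>Inverting the affine map exhibits \<open>K\<close> as a continuous image of the
    connected set \<open>I\<close>.\<close>
  have "K = (\<lambda>x. (x - b) / c) ` I"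
    unfolding img[symmetric] image_image using c(1) by simp
  then have Kc: "connected K"
    using I(2) by (auto intro!: connected_continuous_image continuous_intros simp: c(1))
  have JK: "J \<subseteq> K" using u JI by (force simp: K_def)
  have pos: "?G (b + c * s) > 0" if "s \<in> K" for s
    using rotational_surface_orbit_sq_pos[OF surf] that by (simp add: K_def)
  \<comment> \<open>The loxodrome equation \<open>F c + G v' = sqrt G * cos \<theta>\<close> solved
    for \<open>v'\<close>, written with the generators of \<open>smooth_closure\<close>.\<close>
  define W where "W s = (sqrt (?G (b + c * s)) * cos \<theta> + - c * ?F (b + c * s)) * inverse (?G (b + c * s))" for s
  have W: "?F (b + c * s) * c + ?G (b + c * s) * W s = sqrt (?G (b + c * s)) * cos \<theta>" if "s \<in> K" for s
    using pos[OF that] by (simp add: W_def field_simps)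
  have smoothW: "smooth_curve_on K W"
  proof -
    have "(\<lambda>s. ?F (b + c * s)) \<in> smooth_closure K" "(\<lambda>s. ?G (b + c * s)) \<in> smooth_closure K"
      using smooth_curve_on_compose_affine[OF K smooth_curve_on_shear_orbit_sq(1)[OF surf]]
        smooth_curve_on_compose_affine[OF K smooth_curve_on_shear_orbit_sq(2)[OF surf]]
      by (auto simp: K_def intro: smooth_closure.smooth)
    then have "W \<in> smooth_closure K"
      unfolding W_def using pos
      by (intro smooth_closure.mult smooth_closure.add smooth_closure.sqrt smooth_closure.inverse
          smooth_closure_const K)
        (auto simp: less_imp_neq[symmetric])
    then show ?thesis using smooth_closure_iff[OF K] by simp
  qed
  have "continuous_on K W"
    using smooth_curve_on_has_derivative[OF smoothW] has_vector_derivative_continuous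
    by (blast intro: continuous_at_imp_continuous_on)
  then obtain V where V: "V s0 = 0" "\<And>s. s \<in> K \<Longrightarrow> (V has_real_derivative W s) (at s)"
    using antiderivative_exists[OF K Kc _, of W s0] s0 JK by blast
  define v where "v s = \<gamma> s0 $ 2 + V s" for s
  have v: "(v has_real_derivative W s) (at s)" if "s \<in> K" for s
    unfolding v_def using V(2)[OF that] by (auto intro!: derivative_eq_intros)
  have v\<gamma>: "\<gamma> s $ 2 = v s" if "s \<in> J" for s
  proof -
    have "((\<lambda>s. \<gamma> s $ 2 - v s) has_real_derivative 0) (at t)" if "t \<in> J" for t
    proof -
      have "t \<in> K" using that JK by blast
      \<comment> \<open>The given curve satisfies the same linear equation for \<open>v'\<close>,
        and \<open>G > 0\<close> cancels; hence both angles have derivative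
        \<open>W\<close>.\<close>
      have "?G (b + c * t) * velocity \<gamma> t $ 2 = ?G (b + c * t) * W t"
        using speed[OF that, unfolded u[OF that]] W[OF \<open>t \<in> K\<close>] by linarith
      then have "velocity \<gamma> t $ 2 = W t" using pos[OF \<open>t \<in> K\<close>] by simp
      then show ?thesis
        using d[OF that] v[OF \<open>t \<in> K\<close>] unfolding has_vector_derivative_vec_iff
        by (auto intro!: derivative_eq_intros)
    qed
    then have "(\<lambda>s. \<gamma> s $ 2 - v s) constant_on J"
      using J by (intro has_field_derivative_0_imp_constant_on)
    then have "\<gamma> s $ 2 - v s = \<gamma> s0 $ 2 - v s0"
      using that s0 unfolding constant_on_def by metis
    then show ?thesis using V(1) by (simp add: v_def)
  qed
  define \<beta> :: "real \<Rightarrow> real ^ 2" where "\<beta> s = vector [b + c * s, v s]" for s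
  have d\<beta>: "(\<beta> has_vector_derivative vector [c, W s]) (at s)" if "s \<in> K" for s
    using v[OF that] unfolding \<beta>_def has_vector_derivative_vec_iff forall_2
    by (auto intro!: derivative_eq_intros)
  have "smooth_curve_on K (\<lambda>s. b + c * s)"
    by (rule smooth_curve_on_antiderivative[OF K smooth_curve_on_const[OF K, of c]])
      (auto intro!: derivative_eq_intros)
  moreover have "smooth_curve_on K v"
    by (rule smooth_curve_on_antiderivative[OF K smoothW])
      (use v in \<open>simp add: has_real_derivative_iff_has_vector_derivative\<close>)
  ultimately have "smooth_curve_on K \<beta>"
    unfolding \<beta>_def by (rule smooth_curve_on_pair[OF K])
  moreover have \<beta>I: "\<beta> s $ 1 \<in> I" if "s \<in> K" for s
    using that by (simp add: \<beta>_def K_def)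
  moreover have "let \<alpha> = rot_param f h \<circ> \<beta> in
      \<forall>s\<in>K. bcv_norm l m (\<alpha> s) (velocity \<alpha> s) = 1 \<and>
        bcv_metric l m (\<alpha> s) (velocity \<alpha> s) (rot_field (\<alpha> s))
          = bcv_norm l m (\<alpha> s) (rot_field (\<alpha> s)) * cos \<theta>"
    unfolding Let_def
  proof
    fix s assume "s \<in> K"
    show "bcv_norm l m ((rot_param f h \<circ> \<beta>) s) (velocity (rot_param f h \<circ> \<beta>) s) = 1 \<and>
        bcv_metric l m ((rot_param f h \<circ> \<beta>) s) (velocity (rot_param f h \<circ> \<beta>) s)
          (rot_field ((rot_param f h \<circ> \<beta>) s))
          = bcv_norm l m ((rot_param f h \<circ> \<beta>) s) (rot_field ((rot_param f h \<circ> \<beta>) s)) * cos \<theta>"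
      unfolding loxodrome_condition_iff[OF surf \<beta>I[OF \<open>s \<in> K\<close>] d\<beta>[OF \<open>s \<in> K\<close>]]
      using W[OF \<open>s \<in> K\<close>] c(2) by (simp add: \<beta>_def)
  qed
  moreover have "0 \<le> \<theta>" "\<theta> < pi" using lox by (auto simp: loxodrome_def)
  ultimately have "loxodrome l m I f h \<theta> K \<beta>"
    using K Kc s0 JK unfolding loxodrome_def by blast
  moreover have "\<beta> s = \<gamma> s" if "s \<in> J" for s
    by (simp add: \<beta>_def vec_eq_iff forall_2 u[OF that] v\<gamma>[OF that])
  moreover have "(\<lambda>s. \<beta> s $ 1) ` K = I" using img by (simp add: \<beta>_def)
  ultimately show ?thesis using JK by blast
qed

text \<open>A curve tests only the radii it passes through, so \<open>f\<close> is first shown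
  constant on the traversed part of \<open>I\<close>; an inextendible loxodrome traverses all of
  \<open>I\<close>.\<close>

theorem corollary3p2:
  fixes l m \<theta> :: real and I J :: "real set"
    and f h :: "real \<Rightarrow> real" and \<gamma> :: "real \<Rightarrow> real ^ 2"
  assumes "rotational_surface l m I f h"
    and "loxodrome l m I f h \<theta> J \<gamma>"
    and "\<not> meridian_curve J \<gamma>"
    and "\<not> parallel_curve J \<gamma>"
    and "\<theta> \<noteq> pi / 2"
    and "geodesic_on (first_fundamental_form l m f h) J \<gamma>"
  shows "vertical_cylinder ((\<lambda>s. \<gamma> s $ 1) ` J) f \<and>
    (inextendible_loxodrome l m I f h \<theta> J \<gamma> \<longrightarrow> vertical_cylinder I f)"
proof -
  let ?F = "shear l m f h" and ?G = "\<lambda>u. orbit_sq l m (f u)"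
  have J: "open J" "connected J" "J \<noteq> {}" and smooth: "smooth_curve_on J \<gamma>"
    and JI: "\<And>s. s \<in> J \<Longrightarrow> \<gamma> s $ 1 \<in> I" and \<theta>: "0 \<le> \<theta>" "\<theta> < pi"
    using assms(2) by (auto simp: loxodrome_def)
  obtain s0 where s0: "s0 \<in> J" using J by blast
  have d: "(\<gamma> has_vector_derivative velocity \<gamma> s) (at s)" if "s \<in> J" for s
    by (rule smooth_curve_on_has_derivative[OF smooth that])
  have cond: "?F (\<gamma> s $ 1) * velocity \<gamma> s $ 1 + ?G (\<gamma> s $ 1) * velocity \<gamma> s $ 2 =
      sqrt (?G (\<gamma> s $ 1)) * cos \<theta>" "(velocity \<gamma> s $ 1)\<^sup>2 = (sin \<theta>)\<^sup>2" if "s \<in> J" for s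
    using assms(2) that loxodrome_condition_iff[OF assms(1) JI[OF that] d[OF that], of \<theta>]
    by (simp_all add: loxodrome_def Let_def)
  \<comment> \<open>On \<open>[0, pi)\<close> the cosine vanishes only at
    \<open>pi / 2\<close>.\<close>
  have "cos \<theta> \<noteq> 0"
  proof
    assume "cos \<theta> = 0"
    then have "\<theta> = pi / 2" using cos_inj_pi[of \<theta> "pi / 2"] \<theta> by simp
    then show False using assms(5) by simp
  qed
  have "(\<lambda>s. ?F (\<gamma> s $ 1) * velocity \<gamma> s $ 1 + ?G (\<gamma> s $ 1) * velocity \<gamma> s $ 2) constant_on J"
    using clairaut[OF assms(1) smooth assms(6)] JI J
    by (intro has_field_derivative_0_imp_constant_on) auto
  \<comment> \<open>The conserved momentum equals \<open>sqrt G * cos \<theta>\<close>; cancelling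
    \<open>cos \<theta>\<close> and injectivity of the root leave \<open>G\<close> constant.\<close>
  then have G: "?G (\<gamma> s $ 1) = ?G (\<gamma> s0 $ 1)" if "s \<in> J" for s
    using cond(1) s0 that \<open>cos \<theta> \<noteq> 0\<close> unfolding constant_on_def
    by (metis mult_right_cancel real_sqrt_eq_iff)
  have "f (\<gamma> s $ 1) \<in> {r. 1 + m * r\<^sup>2 \<noteq> 0 \<and> orbit_sq l m r = ?G (\<gamma> s0 $ 1)}" if "s \<in> J" for s
    using G[OF that] rotational_surface_factor_pos[OF assms(1) JI[OF that]] by simp
  then have fin: "finite ((\<lambda>s. f (\<gamma> s $ 1)) ` J)"
    using rotational_surface_orbit_sq_pos[OF assms(1) JI[OF s0]]
    by (intro finite_subset[OF _ finite_orbit_sq_level[of "?G (\<gamma> s0 $ 1)" m l]]) auto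
  have "continuous_on J (\<lambda>s. f (\<gamma> s $ 1))"
  proof (rule continuous_at_imp_continuous_on, rule ballI)
    fix s assume "s \<in> J"
    have "((\<lambda>t. \<gamma> t $ 1) has_real_derivative velocity \<gamma> s $ 1) (at s)"
      using d[OF \<open>s \<in> J\<close>] by (simp add: has_vector_derivative_vec_iff)
    from DERIV_chain2[OF rotational_surface_has_derivative(1)[OF assms(1) JI[OF \<open>s \<in> J\<close>]] this]
    show "isCont (\<lambda>s. f (\<gamma> s $ 1)) s" by (rule DERIV_isCont)
  qed
  \<comment> \<open>A continuous function with finite range on a connected set is constant, so
    membership of the radius in a finite level set already suffices.\<close>
  from continuous_finite_range_constant[OF J(2) this fin]
  have cyl: "vertical_cylinder ((\<lambda>s. \<gamma> s $ 1) ` J) f"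
    by (auto simp: vertical_cylinder_def constant_on_def)
  \<comment> \<open>The same argument excludes a change of sign: \<open>u'\<close> takes at most the
    two values \<open>sin \<theta>\<close> and \<open>- sin \<theta>\<close>.\<close>
  have "(\<lambda>s. velocity \<gamma> s $ 1) ` J \<subseteq> {sin \<theta>, - sin \<theta>}"
    using cond(2) by (auto simp: power2_eq_iff)
  then have "finite ((\<lambda>s. velocity \<gamma> s $ 1) ` J)" by (rule finite_subset) simp
  moreover have "continuous_on J (\<lambda>s. velocity \<gamma> s $ 1)"
  proof (rule continuous_at_imp_continuous_on, rule ballI)
    fix s assume "s \<in> J"
    have "((\<lambda>t. velocity \<gamma> t $ 1) has_real_derivative velocity (velocity \<gamma>) s $ 1) (at s)"
      using smooth_curve_on_has_derivative[OF smooth_curve_on_velocity[OF smooth] \<open>s \<in> J\<close>]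
      by (simp add: has_vector_derivative_vec_iff)
    then show "isCont (\<lambda>s. velocity \<gamma> s $ 1) s" by (rule DERIV_isCont)
  qed
  ultimately have "(\<lambda>s. velocity \<gamma> s $ 1) constant_on J"
    by (intro continuous_finite_range_constant J)
  then obtain c where c: "\<And>s. s \<in> J \<Longrightarrow> velocity \<gamma> s $ 1 = c"
    by (auto simp: constant_on_def)
  \<comment> \<open>A vanishing \<open>u'\<close> would make the curve a parallel.\<close>
  have "c \<noteq> 0"
  proof
    assume "c = 0"
    then have "((\<lambda>s. \<gamma> s $ 1) has_real_derivative 0) (at s)" if "s \<in> J" for s
      using d[OF that] c[OF that] unfolding has_vector_derivative_vec_iff by metis
    then have "parallel_curve J \<gamma>"
      unfolding parallel_curve_def using J by (intro has_field_derivative_0_imp_constant_on)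
    then show False using assms(4) by simp
  qed
  have "vertical_cylinder I f" if inext: "inextendible_loxodrome l m I f h \<theta> J \<gamma>"
  proof -
    obtain K \<beta> where K: "loxodrome l m I f h \<theta> K \<beta>" "J \<subseteq> K" "\<forall>s\<in>J. \<beta> s = \<gamma> s"
      "(\<lambda>s. \<beta> s $ 1) ` K = I"
      using loxodrome_extends[OF assms(1,2) \<open>c \<noteq> 0\<close> _ c] cond(2)[OF s0] c[OF s0] by auto
    \<comment> \<open>Inextendibility identifies the curve with its extension, whose
      \<open>u\<close> has image \<open>I\<close>; constancy on the traversed part is then constancy
      on \<open>I\<close>.\<close>
    have "K = J" using inext K(1-3) unfolding inextendible_loxodrome_def by blast
    then have "(\<lambda>s. \<gamma> s $ 1) ` J = I" using K(3,4) by (metis (mono_tags, lifting) image_cong)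
    then show ?thesis using cyl by simp
  qed
  then show ?thesis using cyl by blast
qed

end
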